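(* For all scaled simplicial sets $(X,T_X),(Y,T_Y),(Z,T_Z)$, the natural associativity isomorphism $(X\times Y)\times Z\cong X\times(Y\times Z)$ of the cartesian product of simplicial sets is also an isomorphism of scaled simplicial sets $$\big((X,T_X)\otimes(Y,T_Y)\big)\otimes(Z,T_Z)\cong(X,T_X)\otimes\big((Y,T_Y)\otimes(Z,T_Z)\big)$$ for the Gray product, and hence the Gray product gives a monoidal structure on the category $\mathrm{Set}_\Delta^{\mathrm{sc}}$ of scaled simplicial sets.
   Context: A scaled simplicial set is a pair $(X,T)$ with $X$ a simplicial set and $T\subseteq X_2$ a set of $2$-simplices ("thin triangles") containing all degenerate ones; maps are simplicial maps preserving thin triangles. The category is $\mathrm{Set}_\Delta^{\mathrm{sc}}$. Gray product: a $2$-simplex $\sigma\colon\Delta^2\to X$ degenerates along $\Delta^{\{i,i+1\}}$ ($i=0,1$) if $\sigma$ is degenerate and $\sigma|_{\Delta^{\{i,i+1\}}}$ is degenerate. $(X,T_X)\otimes(Y,T_Y)$ has underlying simplicial set $X\times Y$, and $(\sigma_X,\sigma_Y)\colon\Delta^2\to X\times Y$ is thin iff $\sigma_X\in T_X$, $\sigma_Y\in T_Y$, and either $\sigma_X$ degenerates along $\Delta^{\{1,2\}}$ or $\sigma_Y$ degenerates along $\Delta^{\{0,1\}}$. The unit is $\Delta^0$ with its unique scaling. *)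

theory Defs
  imports Complex_Main "HOL-Library.FuncSet"
begin

section \<open>Simplicial sets\<close>

text \<open>
  \<open>Delta m n\<close> is the set of order-preserving maps \<open>[m] \<rightarrow> [n]\<close>, where \<open>[n] = {0, \<dots>, n}\<close>.
  Maps are extensional functions throughout (undefined off their domain), so that equality of
  functions is equality of maps.
\<close>

definition Delta :: "nat \<Rightarrow> nat \<Rightarrow> (nat \<Rightarrow> nat) set" where
  "Delta m n = {\<alpha> \<in> {..m} \<rightarrow>\<^sub>E {..n}. mono_on {..m} \<alpha>}"

text \<open>
  \<open>simplices X n\<close> is the set of \<open>n\<close>-simplices and \<open>action X m n \<alpha>\<close> is the map
  \<open>\<alpha>\<^sup>*\<close> from \<open>n\<close>-simplices to \<open>m\<close>-simplices induced by \<open>\<alpha> : [m] \<rightarrow> [n]\<close>.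
\<close>

record 'a sset =
  simplices :: "nat \<Rightarrow> 'a set"
  action :: "nat \<Rightarrow> nat \<Rightarrow> (nat \<Rightarrow> nat) \<Rightarrow> 'a \<Rightarrow> 'a"

definition is_sset :: "'a sset \<Rightarrow> bool" where
  "is_sset X \<longleftrightarrow>
     (\<forall>m n. action X m n \<in> Delta m n \<rightarrow>\<^sub>E (simplices X n \<rightarrow>\<^sub>E simplices X m)) \<and>
     (\<forall>n. \<forall>x\<in>simplices X n. action X n n (\<lambda>i\<in>{..n}. i) x = x) \<and>
     (\<forall>k m n. \<forall>\<beta>\<in>Delta k m. \<forall>\<alpha>\<in>Delta m n. \<forall>x\<in>simplices X n.
        action X k n (compose {..k} \<alpha> \<beta>) x = action X k m \<beta> (action X m n \<alpha> x))"

definition sset_hom :: "'a sset \<Rightarrow> 'b sset \<Rightarrow> (nat \<Rightarrow> 'a \<Rightarrow> 'b) set" where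
  "sset_hom X Y =
     {f. (\<forall>n. f n \<in> simplices X n \<rightarrow>\<^sub>E simplices Y n) \<and>
         (\<forall>m n. \<forall>\<alpha>\<in>Delta m n. \<forall>x\<in>simplices X n.
            f m (action X m n \<alpha> x) = action Y m n \<alpha> (f n x))}"

definition map_id :: "'a sset \<Rightarrow> nat \<Rightarrow> 'a \<Rightarrow> 'a" where
  "map_id X = (\<lambda>n. \<lambda>x\<in>simplices X n. x)"

text \<open>\<open>map_comp X g f\<close> is the composite of \<open>f : X \<rightarrow> Y\<close> and \<open>g : Y \<rightarrow> Z\<close>.\<close>

definition map_comp ::
  "'a sset \<Rightarrow> (nat \<Rightarrow> 'b \<Rightarrow> 'c) \<Rightarrow> (nat \<Rightarrow> 'a \<Rightarrow> 'b) \<Rightarrow> nat \<Rightarrow> 'a \<Rightarrow> 'c" where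
  "map_comp X g f = (\<lambda>n. compose (simplices X n) (g n) (f n))"

definition sset_iso :: "'a sset \<Rightarrow> 'b sset \<Rightarrow> (nat \<Rightarrow> 'a \<Rightarrow> 'b) \<Rightarrow> bool" where
  "sset_iso X Y f \<longleftrightarrow> f \<in> sset_hom X Y \<and>
     (\<exists>g\<in>sset_hom Y X. map_comp X g f = map_id X \<and> map_comp Y f g = map_id Y)"

definition sset_prod :: "'a sset \<Rightarrow> 'b sset \<Rightarrow> ('a \<times> 'b) sset" where
  "sset_prod X Y =
     \<lparr>simplices = (\<lambda>n. simplices X n \<times> simplices Y n),
      action = (\<lambda>m n. \<lambda>\<alpha>\<in>Delta m n. \<lambda>(x, y)\<in>simplices X n \<times> simplices Y n.
        (action X m n \<alpha> x, action Y m n \<alpha> y))\<rparr>"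

definition assoc_map ::
  "'a sset \<Rightarrow> 'b sset \<Rightarrow> 'c sset \<Rightarrow> nat \<Rightarrow> ('a \<times> 'b) \<times> 'c \<Rightarrow> 'a \<times> 'b \<times> 'c" where
  "assoc_map X Y Z =
     (\<lambda>n. \<lambda>((x, y), z)\<in>(simplices X n \<times> simplices Y n) \<times> simplices Z n. (x, y, z))"

text \<open>
  An \<open>n\<close>-simplex \<open>\<Delta>\<^sup>n \<rightarrow> X\<close> is degenerate if it factors through some \<open>\<Delta>\<^sup>m\<close> with \<open>m < n\<close>.
\<close>

definition degenerate :: "'a sset \<Rightarrow> nat \<Rightarrow> 'a \<Rightarrow> bool" where
  "degenerate X n \<sigma> \<longleftrightarrow>
     (\<exists>m<n. \<exists>\<alpha>\<in>Delta n m. \<exists>\<tau>\<in>simplices X m. \<sigma> = action X n m \<alpha> \<tau>)"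


section \<open>Scaled simplicial sets and the Gray product\<close>

type_synonym 'a scaled = "'a sset \<times> 'a set"

definition is_scaled :: "'a scaled \<Rightarrow> bool" where
  "is_scaled A \<longleftrightarrow> is_sset (fst A) \<and> snd A \<subseteq> simplices (fst A) 2 \<and>
     (\<forall>\<sigma>\<in>simplices (fst A) 2. degenerate (fst A) 2 \<sigma> \<longrightarrow> \<sigma> \<in> snd A)"

definition scaled_hom :: "'a scaled \<Rightarrow> 'b scaled \<Rightarrow> (nat \<Rightarrow> 'a \<Rightarrow> 'b) set" where
  "scaled_hom A B = {f \<in> sset_hom (fst A) (fst B). \<forall>\<sigma>\<in>snd A. f 2 \<sigma> \<in> snd B}"

definition scaled_iso :: "'a scaled \<Rightarrow> 'b scaled \<Rightarrow> (nat \<Rightarrow> 'a \<Rightarrow> 'b) \<Rightarrow> bool" where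
  "scaled_iso A B f \<longleftrightarrow> f \<in> scaled_hom A B \<and>
     (\<exists>g\<in>scaled_hom B A.
        map_comp (fst A) g f = map_id (fst A) \<and> map_comp (fst B) f g = map_id (fst B))"

text \<open>
  \<open>degenerates_along X i \<sigma>\<close>: the \<open>2\<close>-simplex \<open>\<sigma>\<close> degenerates along \<open>\<Delta>\<^bsup>{i,i+1}\<^esup>\<close>,
  for \<open>i = 0, 1\<close>.
\<close>

definition degenerates_along :: "'a sset \<Rightarrow> nat \<Rightarrow> 'a \<Rightarrow> bool" where
  "degenerates_along X i \<sigma> \<longleftrightarrow>
     degenerate X 2 \<sigma> \<and> degenerate X 1 (action X 1 2 (\<lambda>j\<in>{..1}. i + j) \<sigma>)"

definition gray :: "'a scaled \<Rightarrow> 'b scaled \<Rightarrow> ('a \<times> 'b) scaled" where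
  "gray A B =
     (sset_prod (fst A) (fst B),
      {(\<sigma>, \<tau>). \<sigma> \<in> snd A \<and> \<tau> \<in> snd B \<and>
         (degenerates_along (fst A) 1 \<sigma> \<or> degenerates_along (fst B) 0 \<tau>)})"


section \<open>Monoidal categories\<close>

locale category =
  fixes obj :: "'o set"
    and arr :: "'m set"
    and dom :: "'m \<Rightarrow> 'o"
    and cod :: "'m \<Rightarrow> 'o"
    and idt :: "'o \<Rightarrow> 'm"
    and cmp :: "'m \<Rightarrow> 'm \<Rightarrow> 'm" (infixr "\<cdot>" 70)
  assumes dom_obj: "f \<in> arr \<Longrightarrow> dom f \<in> obj"
    and cod_obj: "f \<in> arr \<Longrightarrow> cod f \<in> obj"
    and idt_arr: "X \<in> obj \<Longrightarrow> idt X \<in> arr \<and> dom (idt X) = X \<and> cod (idt X) = X"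
    and cmp_arr: "\<lbrakk>f \<in> arr; g \<in> arr; cod f = dom g\<rbrakk>
      \<Longrightarrow> g \<cdot> f \<in> arr \<and> dom (g \<cdot> f) = dom f \<and> cod (g \<cdot> f) = cod g"
    and cmp_idt: "f \<in> arr \<Longrightarrow> f \<cdot> idt (dom f) = f"
    and idt_cmp: "f \<in> arr \<Longrightarrow> idt (cod f) \<cdot> f = f"
    and cmp_assoc: "\<lbrakk>f \<in> arr; g \<in> arr; h \<in> arr; cod f = dom g; cod g = dom h\<rbrakk>
      \<Longrightarrow> (h \<cdot> g) \<cdot> f = h \<cdot> (g \<cdot> f)"
begin

definition hom :: "'o \<Rightarrow> 'o \<Rightarrow> 'm set" where
  "hom X Y = {f \<in> arr. dom f = X \<and> cod f = Y}"

definition iso :: "'o \<Rightarrow> 'o \<Rightarrow> 'm set" where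
  "iso X Y = {f \<in> hom X Y. \<exists>g\<in>hom Y X. g \<cdot> f = idt X \<and> f \<cdot> g = idt Y}"

end

text \<open>
  The object part \<open>\<otimes>\<close> and the arrow part \<open>\<boxtimes>\<close> of the tensor bifunctor are separate parameters;
  \<open>ass\<close>, \<open>lun\<close> and \<open>run\<close> are the associator and the left and right unitors.
\<close>

locale monoidal_category = category obj arr dom cod idt cmp
  for obj :: "'o set"
    and arr :: "'m set"
    and dom :: "'m \<Rightarrow> 'o"
    and cod :: "'m \<Rightarrow> 'o"
    and idt :: "'o \<Rightarrow> 'm"
    and cmp :: "'m \<Rightarrow> 'm \<Rightarrow> 'm" (infixr "\<cdot>" 70) +
  fixes tobj :: "'o \<Rightarrow> 'o \<Rightarrow> 'o" (infixr "\<otimes>" 75)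
    and tarr :: "'m \<Rightarrow> 'm \<Rightarrow> 'm" (infixr "\<boxtimes>" 75)
    and unit :: "'o"
    and ass :: "'o \<Rightarrow> 'o \<Rightarrow> 'o \<Rightarrow> 'm"
    and lun :: "'o \<Rightarrow> 'm"
    and run :: "'o \<Rightarrow> 'm"
  assumes tobj_obj: "\<lbrakk>X \<in> obj; Y \<in> obj\<rbrakk> \<Longrightarrow> X \<otimes> Y \<in> obj"
    and tarr_hom: "\<lbrakk>f \<in> arr; g \<in> arr\<rbrakk> \<Longrightarrow> f \<boxtimes> g \<in> hom (dom f \<otimes> dom g) (cod f \<otimes> cod g)"
    and tarr_idt: "\<lbrakk>X \<in> obj; Y \<in> obj\<rbrakk> \<Longrightarrow> idt X \<boxtimes> idt Y = idt (X \<otimes> Y)"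
    and tarr_cmp: "\<lbrakk>f \<in> arr; g \<in> arr; f' \<in> arr; g' \<in> arr; cod f = dom f'; cod g = dom g'\<rbrakk>
      \<Longrightarrow> (f' \<cdot> f) \<boxtimes> (g' \<cdot> g) = (f' \<boxtimes> g') \<cdot> (f \<boxtimes> g)"
    and unit_obj: "unit \<in> obj"
    and ass_iso: "\<lbrakk>X \<in> obj; Y \<in> obj; Z \<in> obj\<rbrakk>
      \<Longrightarrow> ass X Y Z \<in> iso ((X \<otimes> Y) \<otimes> Z) (X \<otimes> (Y \<otimes> Z))"
    and ass_natural: "\<lbrakk>f \<in> arr; g \<in> arr; h \<in> arr\<rbrakk>
      \<Longrightarrow> ass (cod f) (cod g) (cod h) \<cdot> ((f \<boxtimes> g) \<boxtimes> h)
        = (f \<boxtimes> (g \<boxtimes> h)) \<cdot> ass (dom f) (dom g) (dom h)"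
    and lun_iso: "X \<in> obj \<Longrightarrow> lun X \<in> iso (unit \<otimes> X) X"
    and lun_natural: "f \<in> arr \<Longrightarrow> lun (cod f) \<cdot> (idt unit \<boxtimes> f) = f \<cdot> lun (dom f)"
    and run_iso: "X \<in> obj \<Longrightarrow> run X \<in> iso (X \<otimes> unit) X"
    and run_natural: "f \<in> arr \<Longrightarrow> run (cod f) \<cdot> (f \<boxtimes> idt unit) = f \<cdot> run (dom f)"
    and pentagon: "\<lbrakk>W \<in> obj; X \<in> obj; Y \<in> obj; Z \<in> obj\<rbrakk>
      \<Longrightarrow> ass W X (Y \<otimes> Z) \<cdot> ass (W \<otimes> X) Y Z
        = (idt W \<boxtimes> ass X Y Z) \<cdot> (ass W (X \<otimes> Y) Z \<cdot> (ass W X Y \<boxtimes> idt Z))"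
    and triangle: "\<lbrakk>X \<in> obj; Y \<in> obj\<rbrakk>
      \<Longrightarrow> (idt X \<boxtimes> lun Y) \<cdot> ass X unit Y = run X \<boxtimes> idt Y"


section \<open>The category of scaled simplicial sets and its Gray tensor product\<close>

text \<open>
  The objects of one category must have one type, so the simplices are drawn from a universe
  type \<open>'u\<close>. An injection \<open>e :: 'u \<times> 'u \<Rightarrow> 'u\<close> (available for every infinite \<open>'u\<close>) brings the
  Gray product of two objects, whose simplices are pairs, back into \<open>'u\<close> by renaming simplices along \<open>e\<close>.
\<close>

record 'u arrow =
  adom :: "'u scaled"
  amap :: "nat \<Rightarrow> 'u \<Rightarrow> 'u"
  acod :: "'u scaled"

definition scaled_obj :: "'u scaled set" where
  "scaled_obj = {A. is_scaled A}"

definition scaled_arr :: "'u arrow set" where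
  "scaled_arr =
     {f. is_scaled (adom f) \<and> is_scaled (acod f) \<and> amap f \<in> scaled_hom (adom f) (acod f)}"

definition scaled_id :: "'u scaled \<Rightarrow> 'u arrow" where
  "scaled_id A = \<lparr>adom = A, amap = map_id (fst A), acod = A\<rparr>"

definition scaled_comp :: "'u arrow \<Rightarrow> 'u arrow \<Rightarrow> 'u arrow" where
  "scaled_comp g f =
     \<lparr>adom = adom f, amap = map_comp (fst (adom f)) (amap g) (amap f), acod = acod g\<rparr>"

definition rename_sset :: "('a \<Rightarrow> 'u) \<Rightarrow> 'a sset \<Rightarrow> 'u sset" where
  "rename_sset e X =
     \<lparr>simplices = (\<lambda>n. e ` simplices X n),
      action = (\<lambda>m n. \<lambda>\<alpha>\<in>Delta m n. \<lambda>u\<in>e ` simplices X n. e (action X m n \<alpha> (inv e u)))\<rparr>"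

definition rename_scaled :: "('a \<Rightarrow> 'u) \<Rightarrow> 'a scaled \<Rightarrow> 'u scaled" where
  "rename_scaled e A = (rename_sset e (fst A), e ` snd A)"

definition gray_obj :: "('u \<times> 'u \<Rightarrow> 'u) \<Rightarrow> 'u scaled \<Rightarrow> 'u scaled \<Rightarrow> 'u scaled" where
  "gray_obj e A B = rename_scaled e (gray A B)"

definition gray_arr :: "('u \<times> 'u \<Rightarrow> 'u) \<Rightarrow> 'u arrow \<Rightarrow> 'u arrow \<Rightarrow> 'u arrow" where
  "gray_arr e f g =
     \<lparr>adom = gray_obj e (adom f) (adom g),
      amap = (\<lambda>n. \<lambda>u\<in>simplices (fst (gray_obj e (adom f) (adom g))) n.
        case inv e u of (x, y) \<Rightarrow> e (amap f n x, amap g n y)),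
      acod = gray_obj e (acod f) (acod g)\<rparr>"

text \<open>\<open>\<Delta>\<^sup>0\<close> has exactly one simplex in each dimension, here called \<open>p\<close>.\<close>

definition gray_unit :: "'u \<Rightarrow> 'u scaled" where
  "gray_unit p =
     (\<lparr>simplices = (\<lambda>n. {p}), action = (\<lambda>m n. \<lambda>\<alpha>\<in>Delta m n. \<lambda>x\<in>{p}. p)\<rparr>, {p})"

text \<open>Up to the renaming \<open>e\<close>, this is \<^const>\<open>assoc_map\<close>; the unitors are the projections.\<close>

definition gray_assoc ::
  "('u \<times> 'u \<Rightarrow> 'u) \<Rightarrow> 'u scaled \<Rightarrow> 'u scaled \<Rightarrow> 'u scaled \<Rightarrow> 'u arrow" where
  "gray_assoc e A B C =
     \<lparr>adom = gray_obj e (gray_obj e A B) C,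
      amap = (\<lambda>n. \<lambda>u\<in>simplices (fst (gray_obj e (gray_obj e A B) C)) n.
        case inv e u of (v, z) \<Rightarrow> case inv e v of (x, y) \<Rightarrow> e (x, e (y, z))),
      acod = gray_obj e A (gray_obj e B C)\<rparr>"

definition gray_lunit :: "('u \<times> 'u \<Rightarrow> 'u) \<Rightarrow> 'u \<Rightarrow> 'u scaled \<Rightarrow> 'u arrow" where
  "gray_lunit e p A =
     \<lparr>adom = gray_obj e (gray_unit p) A,
      amap = (\<lambda>n. \<lambda>u\<in>simplices (fst (gray_obj e (gray_unit p) A)) n. snd (inv e u)),
      acod = A\<rparr>"

definition gray_runit :: "('u \<times> 'u \<Rightarrow> 'u) \<Rightarrow> 'u \<Rightarrow> 'u scaled \<Rightarrow> 'u arrow" where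
  "gray_runit e p A =
     \<lparr>adom = gray_obj e A (gray_unit p),
      amap = (\<lambda>n. \<lambda>u\<in>simplices (fst (gray_obj e A (gray_unit p))) n. fst (inv e u)),
      acod = A\<rparr>"

end

theory Submission
  imports Defs
begin

text \<open>
  A \<open>2\<close>-simplex \<open>\<sigma>\<close> degenerates along \<open>\<Delta>\<^bsup>{i,i+1}\<^esup>\<close> exactly if it is fixed by the
  idempotent of \<open>[2]\<close> that collapses this edge and fixes the remaining vertex. Hence a simplex
  of \<open>X \<times> Y\<close> does so iff both components do. Writing \<open>a\<^sub>i, b\<^sub>i, c\<^sub>i\<close> for
  "the component in \<open>X, Y, Z\<close> degenerates along \<open>\<Delta>\<^bsup>{i,i+1}\<^esup>\<close>", thinness in the two
  triple products is \<open>(a\<^sub>1 \<or> b\<^sub>0) \<and> ((a\<^sub>1 \<and> b\<^sub>1) \<or> c\<^sub>0)\<close> and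
  \<open>(b\<^sub>1 \<or> c\<^sub>0) \<and> (a\<^sub>1 \<or> (b\<^sub>0 \<and> c\<^sub>0))\<close>, and both are equivalent to
  \<open>(a\<^sub>1 \<and> b\<^sub>1) \<or> (a\<^sub>1 \<and> c\<^sub>0) \<or> (b\<^sub>0 \<and> c\<^sub>0)\<close>.
\<close>

section \<open>Simplicial sets and maps\<close>

lemma Delta_compose:
  assumes "\<beta> \<in> Delta k m" "\<alpha> \<in> Delta m n"
  shows "compose {..k} \<alpha> \<beta> \<in> Delta k n"
  using assms by (auto simp: Delta_def compose_def mono_on_def PiE_iff)

lemma Delta_id: "(\<lambda>i\<in>{..n}. i) \<in> Delta n n"
  by (auto simp: Delta_def mono_on_def)

lemma action_in:
  "\<lbrakk>is_sset X; \<alpha> \<in> Delta m n; x \<in> simplices X n\<rbrakk> \<Longrightarrow> action X m n \<alpha> x \<in> simplices X m"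
  unfolding is_sset_def by (blast intro: PiE_mem)

lemma action_id: "\<lbrakk>is_sset X; x \<in> simplices X n\<rbrakk> \<Longrightarrow> action X n n (\<lambda>i\<in>{..n}. i) x = x"
  by (auto simp: is_sset_def)

lemma action_compose:
  "\<lbrakk>is_sset X; \<beta> \<in> Delta k m; \<alpha> \<in> Delta m n; x \<in> simplices X n\<rbrakk>
    \<Longrightarrow> action X k m \<beta> (action X m n \<alpha> x) = action X k n (compose {..k} \<alpha> \<beta>) x"
  by (simp add: is_sset_def)

lemma is_ssetI:
  assumes "\<And>m n. action X m n \<in> extensional (Delta m n)"
    and "\<And>m n \<alpha>. \<alpha> \<in> Delta m n \<Longrightarrow> action X m n \<alpha> \<in> simplices X n \<rightarrow>\<^sub>E simplices X m"
    and "\<And>n x. x \<in> simplices X n \<Longrightarrow> action X n n (\<lambda>i\<in>{..n}. i) x = x"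
    and "\<And>k m n \<alpha> \<beta> x. \<lbrakk>\<beta> \<in> Delta k m; \<alpha> \<in> Delta m n; x \<in> simplices X n\<rbrakk>
      \<Longrightarrow> action X k n (compose {..k} \<alpha> \<beta>) x = action X k m \<beta> (action X m n \<alpha> x)"
  shows "is_sset X"
  unfolding is_sset_def
proof (intro conjI allI)
  fix m n
  show "action X m n \<in> Delta m n \<rightarrow>\<^sub>E (simplices X n \<rightarrow>\<^sub>E simplices X m)"
    using assms(1)[of m n] assms(2)[of _ m n] by (subst PiE_iff) blast
qed (use assms(3,4) in blast)+

section \<open>Simplicial maps, their composites and inverses\<close>

lemma sset_hom_in:
  "\<lbrakk>f \<in> sset_hom X Y; x \<in> simplices X n\<rbrakk> \<Longrightarrow> f n x \<in> simplices Y n"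
  unfolding sset_hom_def by blast

lemma sset_hom_action:
  "\<lbrakk>f \<in> sset_hom X Y; \<alpha> \<in> Delta m n; x \<in> simplices X n\<rbrakk>
    \<Longrightarrow> f m (action X m n \<alpha> x) = action Y m n \<alpha> (f n x)"
  by (simp add: sset_hom_def)

text \<open>Each component of a simplicial map is undefined off the simplices, so agreement on
  simplices already forces equality as functions.\<close>

lemma sset_hom_ext:
  assumes "f \<in> sset_hom X Y" "g \<in> sset_hom X Y"
    and "\<And>n x. x \<in> simplices X n \<Longrightarrow> f n x = g n x"
  shows "f = g"
proof
  fix n
  show "f n = g n"
    using assms unfolding sset_hom_def by (intro PiE_ext[of "f n" "simplices X n"]) auto
qed

lemma map_id_hom: "is_sset X \<Longrightarrow> map_id X \<in> sset_hom X X"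
  by (auto simp: sset_hom_def map_id_def action_in)

lemma map_comp_apply: "x \<in> simplices X n \<Longrightarrow> map_comp X g f n x = g n (f n x)"
  by (simp add: map_comp_def compose_def)

lemma map_comp_hom:
  assumes "is_sset X" "f \<in> sset_hom X Y" "g \<in> sset_hom Y Z"
  shows "map_comp X g f \<in> sset_hom X Z"
  unfolding sset_hom_def
proof (intro CollectI conjI allI ballI)
  fix n
  show "map_comp X g f n \<in> simplices X n \<rightarrow>\<^sub>E simplices Z n"
    using assms by (auto simp: map_comp_def compose_def sset_hom_in)
next
  fix m n \<alpha> x assume "\<alpha> \<in> Delta m n" "x \<in> simplices X n"
  then show "map_comp X g f m (action X m n \<alpha> x) = action Z m n \<alpha> (map_comp X g f n x)"
    using assms by (simp add: map_comp_apply action_in sset_hom_action[of f X Y]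
        sset_hom_action[of g Y Z] sset_hom_in)
qed

text \<open>Levelwise bijectivity suffices: every simplex of \<open>Y\<close> has the form
  \<open>f n x\<close>, and on such simplices naturality of \<open>g\<close> is naturality of
  \<open>f\<close> read backwards. The last conclusion computes \<open>g\<close> on values of
  \<open>f\<close>; it is what later decides whether \<open>g\<close> preserves thin
  triangles.\<close>

lemma sset_hom_inverse:
  assumes X: "is_sset X" and f: "f \<in> sset_hom X Y"
    and bij: "\<And>n. bij_betw (f n) (simplices X n) (simplices Y n)"
  obtains g where "g \<in> sset_hom Y X" "map_comp X g f = map_id X" "map_comp Y f g = map_id Y"
    "\<And>n x. x \<in> simplices X n \<Longrightarrow> g n (f n x) = x"
proof -
  \<comment> \<open>The restriction to \<open>simplices Y n\<close> makes \<open>g n\<close>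
    extensional, as membership in \<open>sset_hom\<close> demands.\<close>
  define g where "g = (\<lambda>n. \<lambda>y\<in>simplices Y n. inv_into (simplices X n) (f n) y)"
  have gf: "g n (f n x) = x" if "x \<in> simplices X n" for n x
    using that bij[of n] sset_hom_in[OF f that] by (simp add: g_def bij_betw_inv_into_left)
  have surj: "\<exists>x\<in>simplices X n. y = f n x" if "y \<in> simplices Y n" for n y
    using that bij[of n] unfolding bij_betw_def by blast
  have g: "g \<in> sset_hom Y X"
    unfolding sset_hom_def
  proof (intro CollectI conjI allI ballI)
    fix n
    show "g n \<in> simplices Y n \<rightarrow>\<^sub>E simplices X n"
    proof (rule PiE_I)
      fix y assume "y \<in> simplices Y n"
      then show "g n y \<in> simplices X n" using surj gf by metis
    qed (simp add: g_def)
  next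
    fix m n \<alpha> y assume \<alpha>: "\<alpha> \<in> Delta m n" and "y \<in> simplices Y n"
    then obtain x where x: "x \<in> simplices X n" "y = f n x" using surj by blast
    then show "g m (action Y m n \<alpha> y) = action X m n \<alpha> (g n y)"
      using \<alpha> sset_hom_action[OF f \<alpha>] gf action_in[OF X \<alpha>] by metis
  qed
  have "map_comp X g f = map_id X"
    by (intro ext) (simp add: map_comp_def compose_def map_id_def restrict_def gf)
  moreover have "map_comp Y f g = map_id Y"
  proof (intro ext)
    fix n y
    show "map_comp Y f g n y = map_id Y n y"
    proof (cases "y \<in> simplices Y n")
      case True
      then show ?thesis using surj[OF True] gf by (auto simp: map_comp_apply map_id_def)
    qed (simp add: map_comp_def compose_def map_id_def)
  qed
  ultimately show ?thesis using that g gf by blast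
qed

section \<open>Cartesian products\<close>

lemma simplices_prod: "simplices (sset_prod X Y) n = simplices X n \<times> simplices Y n"
  by (simp add: sset_prod_def)

lemma action_prod:
  "\<lbrakk>\<alpha> \<in> Delta m n; x \<in> simplices X n; y \<in> simplices Y n\<rbrakk>
    \<Longrightarrow> action (sset_prod X Y) m n \<alpha> (x, y) = (action X m n \<alpha> x, action Y m n \<alpha> y)"
  by (simp add: sset_prod_def)

lemma is_sset_prod:
  assumes "is_sset X" "is_sset Y"
  shows "is_sset (sset_prod X Y)"
proof (rule is_ssetI)
  fix m n \<alpha> assume "\<alpha> \<in> Delta m n"
  then show "action (sset_prod X Y) m n \<alpha>
      \<in> simplices (sset_prod X Y) n \<rightarrow>\<^sub>E simplices (sset_prod X Y) m"
    using assms by (auto simp: sset_prod_def action_in)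
next
  fix n x assume "x \<in> simplices (sset_prod X Y) n"
  then show "action (sset_prod X Y) n n (\<lambda>i\<in>{..n}. i) x = x"
    using assms by (auto simp: simplices_prod action_prod Delta_id action_id)
next
  fix k m n \<alpha> \<beta> x
  assume "\<beta> \<in> Delta k m" "\<alpha> \<in> Delta m n" "x \<in> simplices (sset_prod X Y) n"
  then show "action (sset_prod X Y) k n (compose {..k} \<alpha> \<beta>) x
      = action (sset_prod X Y) k m \<beta> (action (sset_prod X Y) m n \<alpha> x)"
    using assms
    by (auto simp: simplices_prod action_prod Delta_compose action_compose action_in)
qed (simp add: sset_prod_def)

section \<open>Renaming simplices along an injection\<close>

lemma simplices_rename: "simplices (rename_sset e X) n = e ` simplices X n"
  by (simp add: rename_sset_def)

lemma action_rename:
  "\<lbrakk>inj e; \<alpha> \<in> Delta m n; x \<in> simplices X n\<rbrakk>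
    \<Longrightarrow> action (rename_sset e X) m n \<alpha> (e x) = e (action X m n \<alpha> x)"
  by (simp add: rename_sset_def)

lemma is_sset_rename:
  assumes "inj e" "is_sset X"
  shows "is_sset (rename_sset e X)"
proof (rule is_ssetI)
  fix m n \<alpha> assume "\<alpha> \<in> Delta m n"
  then show "action (rename_sset e X) m n \<alpha>
      \<in> simplices (rename_sset e X) n \<rightarrow>\<^sub>E simplices (rename_sset e X) m"
    using assms by (auto simp: rename_sset_def action_in)
next
  fix n x assume "x \<in> simplices (rename_sset e X) n"
  then show "action (rename_sset e X) n n (\<lambda>i\<in>{..n}. i) x = x"
    using assms by (auto simp: simplices_rename action_rename Delta_id action_id)
next
  fix k m n \<alpha> \<beta> x
  assume "\<beta> \<in> Delta k m" "\<alpha> \<in> Delta m n" "x \<in> simplices (rename_sset e X) n"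
  then show "action (rename_sset e X) k n (compose {..k} \<alpha> \<beta>) x
      = action (rename_sset e X) k m \<beta> (action (rename_sset e X) m n \<alpha> x)"
    using assms
    by (auto simp: simplices_rename action_rename Delta_compose action_compose action_in)
qed (simp add: rename_sset_def)

lemma degenerate_hom:
  assumes "f \<in> sset_hom X Y" "degenerate X n \<sigma>"
  shows "degenerate Y n (f n \<sigma>)"
proof -
  obtain m \<alpha> \<tau> where "m < n" "\<alpha> \<in> Delta n m" "\<tau> \<in> simplices X m" "\<sigma> = action X n m \<alpha> \<tau>"
    using assms(2) unfolding degenerate_def by blast
  then show ?thesis
    unfolding degenerate_def using sset_hom_action[OF assms(1)] sset_hom_in[OF assms(1)] by blast
qed

section \<open>Degeneracy along an edge\<close>

text \<open>Being fixed by \<open>collapse i\<close> will replace the two existential statements in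
  \<open>degenerates_along\<close>. A single equation between simplices can be checked componentwise
  in a product and cancelled along an injection.\<close>

definition collapse :: "nat \<Rightarrow> nat \<Rightarrow> nat" where
  "collapse i = (\<lambda>j\<in>{..2}. if j = Suc i then i else j)"

lemma collapse_Delta: "i < 2 \<Longrightarrow> collapse i \<in> Delta 2 2"
  by (auto simp: collapse_def Delta_def mono_on_def)

lemma edge_Delta: "i < 2 \<Longrightarrow> (\<lambda>j\<in>{..1}. i + j) \<in> Delta 1 2"
  by (auto simp: Delta_def mono_on_def)

text \<open>Meant for \<open>m < 2\<close>: a weakly increasing chain of three values in {0, 1} has
  two equal neighbours, and for \<open>m = 0\<close> all values are equal.\<close>

lemma Delta_2_D:
  assumes "\<alpha> \<in> Delta 2 m"
  shows "\<alpha> 0 \<le> \<alpha> 1" "\<alpha> 1 \<le> \<alpha> 2" "\<alpha> 2 \<le> m"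
proof -
  have "mono_on {..2} \<alpha>" and *: "\<alpha> 2 \<in> {..m}"
    using assms by (auto simp: Delta_def PiE_iff)
  then show "\<alpha> 0 \<le> \<alpha> 1" "\<alpha> 1 \<le> \<alpha> 2"
    by (auto elim!: mono_onD)
  show "\<alpha> 2 \<le> m" using * by simp
qed

text \<open>A map \<alpha> that identifies \<open>i\<close> and \<open>Suc i\<close> is unchanged by
  precomposition with \<open>collapse i\<close>; functoriality of the action does the rest.\<close>

lemma collapse_fixes:
  assumes X: "is_sset X" and \<alpha>: "\<alpha> \<in> Delta 2 m" and \<tau>: "\<tau> \<in> simplices X m"
    and i: "i < 2" and eq: "\<alpha> i = \<alpha> (Suc i)"
  shows "action X 2 2 (collapse i) (action X 2 m \<alpha> \<tau>) = action X 2 m \<alpha> \<tau>"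
proof -
  have ext: "\<alpha> \<in> extensional {..2}"
    using \<alpha> by (simp add: Delta_def PiE_iff)
  have "compose {..2} \<alpha> (collapse i) = \<alpha>"
    using i eq ext by (intro extensionalityI[OF compose_extensional ext])
      (auto simp: compose_def collapse_def)
  then show ?thesis
    by (simp add: action_compose[OF X collapse_Delta[OF i] \<alpha> \<tau>])
qed

text \<open>If \<sigma> is fixed, it is degenerate because \<open>collapse i\<close> factors through
  [1], and its edge is degenerate because \<open>collapse i\<close> is constant there. Conversely,
  write \<sigma> as the pullback of \<tau> along \<alpha>. Either \<alpha> identifies the ends of
  the edge, or \<tau> is the edge itself; in the latter case degeneracy of the edge makes \<sigma>
  the pullback of a vertex.\<close>

lemma degenerates_along_iff:
  assumes X: "is_sset X" and \<sigma>: "\<sigma> \<in> simplices X 2" and i: "i < 2"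
  shows "degenerates_along X i \<sigma> \<longleftrightarrow> action X 2 2 (collapse i) \<sigma> = \<sigma>"
proof
  let ?E = "\<lambda>j\<in>{..1}. i + j"
  assume fixed: "action X 2 2 (collapse i) \<sigma> = \<sigma>"
  \<comment> \<open>The epi-mono factorization of \<open>collapse i\<close>: \<open>s\<close>
    identifies \<open>i\<close> with \<open>Suc i\<close>, and \<open>d\<close> picks the least
    element of each fibre of \<open>s\<close>.\<close>
  define s where "s = (\<lambda>j\<in>{..2::nat}. if i + j \<le> 1 then 0 else 1 :: nat)"
  define d where "d = (\<lambda>j\<in>{..1::nat}. if j = 0 then 0 else if i = 0 then 2 else 1 :: nat)"
  have i01: "i = 0 \<or> i = 1" using i by auto
  have Delta: "s \<in> Delta 2 1" "d \<in> Delta 1 2" "(\<lambda>j\<in>{..0}. i) \<in> Delta 0 2"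
    "(\<lambda>j\<in>{..1}. 0) \<in> Delta 1 0"
    using i01 by (auto simp: s_def d_def Delta_def mono_on_def)
  have "compose {..2} d s = collapse i"
    using i01 by (auto simp: compose_def s_def d_def collapse_def fun_eq_iff le_Suc_eq numeral_2_eq_2)
  then have "\<sigma> = action X 2 1 s (action X 1 2 d \<sigma>)"
    using fixed action_compose[OF X Delta(1,2) \<sigma>] by simp
  then have "degenerate X 2 \<sigma>"
    unfolding degenerate_def using Delta(1) action_in[OF X Delta(2) \<sigma>] one_less_numeral_iff
      semiring_norm(76) by blast
  \<comment> \<open>Restricted to the edge, \<open>collapse i\<close> is constant with value
    \<open>i\<close>, so it factors through [0].\<close>
  moreover have "compose {..1} (collapse i) ?E = compose {..1} (\<lambda>j\<in>{..0::nat}. i) (\<lambda>j\<in>{..1}. 0)"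
    using i01 by (auto simp: compose_def collapse_def fun_eq_iff le_Suc_eq)
  then have "action X 1 2 ?E \<sigma> = action X 1 0 (\<lambda>j\<in>{..1}. 0) (action X 0 2 (\<lambda>j\<in>{..0}. i) \<sigma>)"
    using fixed action_compose[OF X edge_Delta[OF i] collapse_Delta[OF i] \<sigma>]
      action_compose[OF X Delta(4,3) \<sigma>] by simp
  then have "degenerate X 1 (action X 1 2 ?E \<sigma>)"
    unfolding degenerate_def using Delta(4) action_in[OF X Delta(3) \<sigma>] zero_less_one by blast
  ultimately show "degenerates_along X i \<sigma>"
    by (simp add: degenerates_along_def)
next
  let ?E = "\<lambda>j\<in>{..1}. i + j"
  assume along: "degenerates_along X i \<sigma>"
  then obtain m \<alpha> \<tau> where m: "m < 2" and \<alpha>: "\<alpha> \<in> Delta 2 m" and \<tau>: "\<tau> \<in> simplices X m"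
    and \<sigma>_eq: "\<sigma> = action X 2 m \<alpha> \<tau>"
    unfolding degenerates_along_def degenerate_def by blast
  show "action X 2 2 (collapse i) \<sigma> = \<sigma>"
  proof (cases "\<alpha> i = \<alpha> (Suc i)")
    case True
    then show ?thesis using collapse_fixes[OF X \<alpha> \<tau> i] \<sigma>_eq by simp
  next
    case False
    have i01: "i = 0 \<or> i = 1" using i by auto
    \<comment> \<open>Two distinct adjacent values of a monotone map into [m] with
      \<open>m < 2\<close> must be 0 and 1.\<close>
    have m1: "m = 1" and vals: "\<alpha> i = 0" "\<alpha> (Suc i) = 1"
      using Delta_2_D[OF \<alpha>] m False i01 by (auto simp: numeral_2_eq_2)
    \<comment> \<open>Hence \<alpha> is the identity along the edge, which identifies the edge of
      \<sigma> with \<tau>; the second half of the hypothesis now says that \<tau> is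
      degenerate.\<close>
    have "compose {..1} \<alpha> ?E = (\<lambda>j\<in>{..1}. j)"
      using vals by (auto simp: compose_def fun_eq_iff le_Suc_eq)
    then have edge: "action X 1 2 ?E \<sigma> = \<tau>"
      using action_compose[OF X edge_Delta[OF i] \<alpha> \<tau>] action_id[OF X] \<tau> m1 \<sigma>_eq by simp
    then obtain \<beta> \<rho> where \<beta>: "\<beta> \<in> Delta 1 0" and \<rho>: "\<rho> \<in> simplices X 0"
      and \<tau>_eq: "\<tau> = action X 1 0 \<beta> \<rho>"
      using along unfolding degenerates_along_def degenerate_def by auto
    \<comment> \<open>The composite lands in [0], so it identifies all vertices and
      \<open>collapse_fixes\<close> applies to it.\<close>
    have \<beta>\<alpha>: "compose {..2} \<beta> \<alpha> \<in> Delta 2 0"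
      using \<alpha> \<beta> m1 Delta_compose by blast
    have "\<sigma> = action X 2 0 (compose {..2} \<beta> \<alpha>) \<rho>"
      using \<sigma>_eq \<tau>_eq m1 \<alpha> \<beta> \<rho> action_compose[OF X] by metis
    moreover have "compose {..2} \<beta> \<alpha> i = compose {..2} \<beta> \<alpha> (Suc i)"
      using Delta_2_D[OF \<beta>\<alpha>] i01 by (auto simp: numeral_2_eq_2)
    ultimately show ?thesis
      using collapse_fixes[OF X \<beta>\<alpha> \<rho> i] by simp
  qed
qed

text \<open>A monotone map from [2] to [m] with \<open>m < 2\<close> is not injective, and
  monotonicity makes two neighbours collide. So every degenerate triangle degenerates along one of
  the two edges.\<close>

lemma degenerate_2D:
  assumes X: "is_sset X" and deg: "degenerate X 2 \<sigma>"
  shows "\<exists>i<2. action X 2 2 (collapse i) \<sigma> = \<sigma>"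
proof -
  obtain m \<alpha> \<tau> where m: "m < 2" and \<alpha>: "\<alpha> \<in> Delta 2 m" and \<tau>: "\<tau> \<in> simplices X m"
    and \<sigma>_eq: "\<sigma> = action X 2 m \<alpha> \<tau>"
    using deg unfolding degenerate_def by blast
  have "\<alpha> 0 = \<alpha> (Suc 0) \<or> \<alpha> 1 = \<alpha> (Suc 1)"
    using Delta_2_D[OF \<alpha>] m by (auto simp: numeral_2_eq_2)
  then show ?thesis
    using collapse_fixes[OF X \<alpha> \<tau>, of 0] collapse_fixes[OF X \<alpha> \<tau>, of 1] \<sigma>_eq
    by (metis one_less_numeral_iff pos2 semiring_norm(76))
qed

text \<open>Simplicial maps preserve degeneracy of the triangle and, by naturality at the edge
  inclusion, that of its edge. This makes the Gray product functorial.\<close>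

lemma degenerates_along_hom:
  assumes "f \<in> sset_hom X Y" "\<sigma> \<in> simplices X 2" "i < 2" "degenerates_along X i \<sigma>"
  shows "degenerates_along Y i (f 2 \<sigma>)"
  using assms(4) degenerate_hom[OF assms(1)] sset_hom_action[OF assms(1) edge_Delta assms(2)] assms(3)
  unfolding degenerates_along_def by metis

text \<open>Two degenerate components do not make a degenerate pair, since they may degenerate along
  different edges. The fixed-point equation names the same collapse for both components and
  therefore splits.\<close>

lemma degenerates_along_prod:
  assumes "is_sset X" "is_sset Y" "\<sigma> \<in> simplices X 2" "\<tau> \<in> simplices Y 2" "i < 2"
  shows "degenerates_along (sset_prod X Y) i (\<sigma>, \<tau>)
    \<longleftrightarrow> degenerates_along X i \<sigma> \<and> degenerates_along Y i \<tau>"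
  using assms
  by (simp add: degenerates_along_iff is_sset_prod simplices_prod action_prod collapse_Delta)

lemma degenerates_along_rename:
  assumes "inj e" "is_sset X" "\<sigma> \<in> simplices X 2" "i < 2"
  shows "degenerates_along (rename_sset e X) i (e \<sigma>) \<longleftrightarrow> degenerates_along X i \<sigma>"
  using assms by (simp add: degenerates_along_iff is_sset_rename simplices_rename action_rename
      collapse_Delta inj_eq)

section \<open>The Gray product\<close>

lemma is_scaled_sset: "is_scaled A \<Longrightarrow> is_sset (fst A)"
  by (simp add: is_scaled_def)

lemma thin_simplex: "\<lbrakk>is_scaled A; \<sigma> \<in> snd A\<rbrakk> \<Longrightarrow> \<sigma> \<in> simplices (fst A) 2"
  by (auto simp: is_scaled_def)

text \<open>By \<open>degenerate_2D\<close>, thinness of degenerate triangles need only be tested on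
  triangles degenerating along a given edge, a condition that splits over products.\<close>

lemma is_scaledI:
  assumes "is_sset (fst A)" "snd A \<subseteq> simplices (fst A) 2"
    and "\<And>\<sigma> i. \<lbrakk>\<sigma> \<in> simplices (fst A) 2; i < 2; degenerates_along (fst A) i \<sigma>\<rbrakk> \<Longrightarrow> \<sigma> \<in> snd A"
  shows "is_scaled A"
  using assms degenerate_2D[OF assms(1)] degenerates_along_iff[OF assms(1)]
  unfolding is_scaled_def by blast

lemma degenerates_along_thin:
  "\<lbrakk>is_scaled A; \<sigma> \<in> simplices (fst A) 2; degenerates_along (fst A) i \<sigma>\<rbrakk> \<Longrightarrow> \<sigma> \<in> snd A"
  by (simp add: is_scaled_def degenerates_along_def)

lemma fst_gray: "fst (gray A B) = sset_prod (fst A) (fst B)"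
  by (simp add: gray_def)

lemma thin_gray:
  "(\<sigma>, \<tau>) \<in> snd (gray A B) \<longleftrightarrow> \<sigma> \<in> snd A \<and> \<tau> \<in> snd B \<and>
     (degenerates_along (fst A) 1 \<sigma> \<or> degenerates_along (fst B) 0 \<tau>)"
  by (simp add: gray_def)

lemma is_scaled_gray:
  assumes A: "is_scaled A" and B: "is_scaled B"
  shows "is_scaled (gray A B)"
proof (rule is_scaledI)
  show "is_sset (fst (gray A B))"
    using A B by (simp add: fst_gray is_sset_prod is_scaled_sset)
  show "snd (gray A B) \<subseteq> simplices (fst (gray A B)) 2"
    using A B by (auto simp: thin_gray fst_gray simplices_prod thin_simplex)
next
  fix \<sigma> and i :: nat
  assume "\<sigma> \<in> simplices (fst (gray A B)) 2" and i: "i < 2"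
    and deg: "degenerates_along (fst (gray A B)) i \<sigma>"
  then obtain x y where \<sigma>: "\<sigma> = (x, y)" and xy: "x \<in> simplices (fst A) 2" "y \<in> simplices (fst B) 2"
    by (auto simp: fst_gray simplices_prod)
  have "degenerates_along (fst A) i x" "degenerates_along (fst B) i y"
    using deg degenerates_along_prod[OF is_scaled_sset[OF A] is_scaled_sset[OF B] xy i]
    by (simp_all add: \<sigma> fst_gray)
  \<comment> \<open>For \<open>i = 1\<close> the first component satisfies the Gray condition, for
    \<open>i = 0\<close> the second.\<close>
  moreover have "i = 0 \<or> i = 1" using i by auto
  ultimately show "\<sigma> \<in> snd (gray A B)"
    using A B xy by (auto simp: \<sigma> thin_gray degenerates_along_thin)
qed

text \<open>Thinness of the components supplies the memberships needed to split degeneracy of pairs;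
  what remains is a propositional equivalence.\<close>

lemma thin_gray_gray:
  assumes "is_scaled A" "is_scaled B" "is_scaled C"
  shows "((x, y), z) \<in> snd (gray (gray A B) C) \<longleftrightarrow> (x, y, z) \<in> snd (gray A (gray B C))"
  unfolding thin_gray fst_gray
  using assms by (auto simp: degenerates_along_prod is_scaled_sset thin_simplex)

text \<open>A bijective map preserving thin triangles may have an inverse that does not. Hence
  \<open>thin\<close> is an equivalence: its forward direction makes the inverse a scaled
  map.\<close>

lemma scaled_isoI:
  assumes A: "is_scaled A" and B: "is_scaled B" and f: "f \<in> sset_hom (fst A) (fst B)"
    and bij: "\<And>n. bij_betw (f n) (simplices (fst A) n) (simplices (fst B) n)"
    and thin: "\<And>\<sigma>. \<sigma> \<in> simplices (fst A) 2 \<Longrightarrow> f 2 \<sigma> \<in> snd B \<longleftrightarrow> \<sigma> \<in> snd A"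
  shows "scaled_iso A B f"
proof -
  obtain g where g: "g \<in> sset_hom (fst B) (fst A)"
    "map_comp (fst A) g f = map_id (fst A)" "map_comp (fst B) f g = map_id (fst B)"
    and gf: "\<And>n x. x \<in> simplices (fst A) n \<Longrightarrow> g n (f n x) = x"
    using sset_hom_inverse[OF is_scaled_sset[OF A] f bij] by metis
  have "g 2 \<tau> \<in> snd A" if \<tau>: "\<tau> \<in> snd B" for \<tau>
  proof -
    obtain \<sigma> where "\<sigma> \<in> simplices (fst A) 2" "\<tau> = f 2 \<sigma>"
      using bij[of 2] thin_simplex[OF B \<tau>] unfolding bij_betw_def by blast
    then show ?thesis using gf thin \<tau> by simp
  qed
  then have "g \<in> scaled_hom B A" using g(1) by (simp add: scaled_hom_def)
  moreover have "f \<in> scaled_hom A B"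
    using f thin thin_simplex[OF A] by (simp add: scaled_hom_def)
  ultimately show ?thesis using g(2,3) unfolding scaled_iso_def by blast
qed

section \<open>The associativity isomorphism on triples\<close>

lemma assoc_map_hom:
  assumes "is_sset X" "is_sset Y" "is_sset Z"
  shows "assoc_map X Y Z
    \<in> sset_hom (sset_prod (sset_prod X Y) Z) (sset_prod X (sset_prod Y Z))"
  using assms by (auto simp: sset_hom_def assoc_map_def simplices_prod action_prod action_in)

lemma assoc_map_bij:
  "bij_betw (assoc_map X Y Z n) (simplices (sset_prod (sset_prod X Y) Z) n)
     (simplices (sset_prod X (sset_prod Y Z)) n)"
  by (rule bij_betw_byWitness[where f' = "\<lambda>(x, y, z). ((x, y), z)"])
    (auto simp: assoc_map_def simplices_prod)

lemma assoc_map_sset_iso: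
  assumes "is_sset X" "is_sset Y" "is_sset Z"
  shows "sset_iso (sset_prod (sset_prod X Y) Z) (sset_prod X (sset_prod Y Z)) (assoc_map X Y Z)"
  using sset_hom_inverse[OF _ assoc_map_hom[OF assms] assoc_map_bij]
    assoc_map_hom[OF assms] assms is_sset_prod unfolding sset_iso_def by metis

lemma assoc_map_scaled_iso:
  assumes "is_scaled A" "is_scaled B" "is_scaled C"
  shows "scaled_iso (gray (gray A B) C) (gray A (gray B C)) (assoc_map (fst A) (fst B) (fst C))"
proof (rule scaled_isoI)
  fix \<sigma> assume "\<sigma> \<in> simplices (fst (gray (gray A B) C)) 2"
  then show "assoc_map (fst A) (fst B) (fst C) 2 \<sigma> \<in> snd (gray A (gray B C))
      \<longleftrightarrow> \<sigma> \<in> snd (gray (gray A B) C)"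
    using thin_gray_gray[OF assms] by (auto simp: fst_gray simplices_prod assoc_map_def)
qed (use assms in \<open>simp_all add: fst_gray is_scaled_gray assoc_map_hom assoc_map_bij is_scaled_sset\<close>)

section \<open>The monoidal structure\<close>

lemma is_scaled_rename:
  assumes e: "inj e" and A: "is_scaled A"
  shows "is_scaled (rename_scaled e A)"
proof (rule is_scaledI)
  show "is_sset (fst (rename_scaled e A))"
    using assms by (simp add: rename_scaled_def is_sset_rename is_scaled_sset)
  show "snd (rename_scaled e A) \<subseteq> simplices (fst (rename_scaled e A)) 2"
    using A by (auto simp: rename_scaled_def simplices_rename thin_simplex)
next
  fix \<sigma> and i :: nat
  assume "\<sigma> \<in> simplices (fst (rename_scaled e A)) 2" "i < 2"
    "degenerates_along (fst (rename_scaled e A)) i \<sigma>"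
  then show "\<sigma> \<in> snd (rename_scaled e A)"
    using assms by (auto simp: rename_scaled_def simplices_rename degenerates_along_rename
        is_scaled_sset degenerates_along_thin)
qed

lemma is_scaled_gray_obj: "\<lbrakk>inj e; is_scaled A; is_scaled B\<rbrakk> \<Longrightarrow> is_scaled (gray_obj e A B)"
  by (simp add: gray_obj_def is_scaled_rename is_scaled_gray)

lemma simplices_gray_obj:
  "simplices (fst (gray_obj e A B)) n = e ` (simplices (fst A) n \<times> simplices (fst B) n)"
  by (simp add: gray_obj_def rename_scaled_def simplices_rename fst_gray simplices_prod)

lemma action_gray_obj:
  "\<lbrakk>inj e; \<alpha> \<in> Delta m n; x \<in> simplices (fst A) n; y \<in> simplices (fst B) n\<rbrakk>
    \<Longrightarrow> action (fst (gray_obj e A B)) m n \<alpha> (e (x, y))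
      = e (action (fst A) m n \<alpha> x, action (fst B) m n \<alpha> y)"
  by (simp add: gray_obj_def rename_scaled_def action_rename fst_gray simplices_prod action_prod)

lemma thin_gray_obj:
  "inj e \<Longrightarrow> e (\<sigma>, \<tau>) \<in> snd (gray_obj e A B) \<longleftrightarrow> \<sigma> \<in> snd A \<and> \<tau> \<in> snd B \<and>
     (degenerates_along (fst A) 1 \<sigma> \<or> degenerates_along (fst B) 0 \<tau>)"
  by (simp add: gray_obj_def rename_scaled_def inj_image_mem_iff thin_gray)

lemma degenerates_along_gray_obj:
  assumes "inj e" "is_scaled A" "is_scaled B" "\<sigma> \<in> simplices (fst A) 2" "\<tau> \<in> simplices (fst B) 2"
    "i < 2"
  shows "degenerates_along (fst (gray_obj e A B)) i (e (\<sigma>, \<tau>))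
    \<longleftrightarrow> degenerates_along (fst A) i \<sigma> \<and> degenerates_along (fst B) i \<tau>"
  using assms by (simp add: gray_obj_def rename_scaled_def fst_gray degenerates_along_rename
      is_sset_prod simplices_prod is_scaled_sset degenerates_along_prod)

lemma is_sset_gray_unit: "is_sset (fst (gray_unit p))"
  by (rule is_ssetI) (auto simp: gray_unit_def Delta_id Delta_compose)

lemma is_scaled_gray_unit: "is_scaled (gray_unit p)"
  by (rule is_scaledI[OF is_sset_gray_unit]) (auto simp: gray_unit_def)

text \<open>The unique triangle is fixed by every map, so it degenerates along both edges. Pairing
  with the unit therefore satisfies the Gray condition on either side.\<close>

lemma degenerates_along_gray_unit: "i < 2 \<Longrightarrow> degenerates_along (fst (gray_unit p)) i p"
  using is_sset_gray_unit[of p] collapse_Delta[of i]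
  by (subst degenerates_along_iff) (auto simp: gray_unit_def)

text \<open>Reduces the category laws and all coherence equations to a comparison of values on
  simplices.\<close>

lemma scaled_arr_eqI:
  assumes "f \<in> scaled_arr" "g \<in> scaled_arr" "adom f = adom g" "acod f = acod g"
    and "\<And>n x. x \<in> simplices (fst (adom f)) n \<Longrightarrow> amap f n x = amap g n x"
  shows "f = g"
proof -
  have "amap f = amap g"
    using assms by (intro sset_hom_ext) (auto simp: scaled_arr_def scaled_hom_def)
  then show ?thesis using assms(3,4) by simp
qed

lemma scaled_arrD:
  assumes "f \<in> scaled_arr"
  shows "is_scaled (adom f)" "is_scaled (acod f)" "amap f \<in> sset_hom (fst (adom f)) (fst (acod f))"
    "\<And>\<sigma>. \<sigma> \<in> snd (adom f) \<Longrightarrow> amap f 2 \<sigma> \<in> snd (acod f)"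
  using assms by (auto simp: scaled_arr_def scaled_hom_def)

lemma amap_in:
  "\<lbrakk>f \<in> scaled_arr; x \<in> simplices (fst (adom f)) n\<rbrakk> \<Longrightarrow> amap f n x \<in> simplices (fst (acod f)) n"
  by (meson scaled_arrD(3) sset_hom_in)

lemma amap_action:
  "\<lbrakk>f \<in> scaled_arr; \<alpha> \<in> Delta m n; x \<in> simplices (fst (adom f)) n\<rbrakk>
    \<Longrightarrow> amap f m (action (fst (adom f)) m n \<alpha> x) = action (fst (acod f)) m n \<alpha> (amap f n x)"
  by (meson scaled_arrD(3) sset_hom_action)

lemma adom_acod_simps [simp]:
  "adom (scaled_id A) = A" "acod (scaled_id A) = A"
  "adom (scaled_comp g f) = adom f" "acod (scaled_comp g f) = acod g"
  "adom (gray_arr e f g) = gray_obj e (adom f) (adom g)"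
  "acod (gray_arr e f g) = gray_obj e (acod f) (acod g)"
  "adom (gray_assoc e A B C) = gray_obj e (gray_obj e A B) C"
  "acod (gray_assoc e A B C) = gray_obj e A (gray_obj e B C)"
  "adom (gray_lunit e p A) = gray_obj e (gray_unit p) A" "acod (gray_lunit e p A) = A"
  "adom (gray_runit e p A) = gray_obj e A (gray_unit p)" "acod (gray_runit e p A) = A"
  by (simp_all add: scaled_id_def scaled_comp_def gray_arr_def gray_assoc_def gray_lunit_def
      gray_runit_def)

lemma amap_scaled_id: "x \<in> simplices (fst A) n \<Longrightarrow> amap (scaled_id A) n x = x"
  by (simp add: scaled_id_def map_id_def)

lemma amap_scaled_comp:
  "x \<in> simplices (fst (adom f)) n \<Longrightarrow> amap (scaled_comp g f) n x = amap g n (amap f n x)"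
  by (simp add: scaled_comp_def map_comp_apply)

text \<open>Evaluation is stated on simplices already in the form \<open>e (x, y)\<close>, where
  injectivity cancels \<open>inv e\<close>; the rules for associator and unitors follow the same
  pattern.\<close>

lemma amap_gray_arr:
  "\<lbrakk>inj e; x \<in> simplices (fst (adom f)) n; y \<in> simplices (fst (adom g)) n\<rbrakk>
    \<Longrightarrow> amap (gray_arr e f g) n (e (x, y)) = e (amap f n x, amap g n y)"
  by (simp add: gray_arr_def simplices_gray_obj)

lemma amap_gray_assoc:
  "\<lbrakk>inj e; x \<in> simplices (fst A) n; y \<in> simplices (fst B) n; z \<in> simplices (fst C) n\<rbrakk>
    \<Longrightarrow> amap (gray_assoc e A B C) n (e (e (x, y), z)) = e (x, e (y, z))"
  by (simp add: gray_assoc_def simplices_gray_obj)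

lemma simplices_gray_unit: "simplices (fst (gray_unit p)) n = {p}"
  by (simp add: gray_unit_def)

lemma action_gray_unit: "\<alpha> \<in> Delta m n \<Longrightarrow> action (fst (gray_unit p)) m n \<alpha> p = p"
  by (simp add: gray_unit_def)

lemma thin_gray_unit: "snd (gray_unit p) = {p}"
  by (simp add: gray_unit_def)

lemma amap_gray_lunit:
  "\<lbrakk>inj e; x \<in> simplices (fst A) n\<rbrakk> \<Longrightarrow> amap (gray_lunit e p A) n (e (p, x)) = x"
  by (simp add: gray_lunit_def simplices_gray_obj simplices_gray_unit)

lemma amap_gray_runit:
  "\<lbrakk>inj e; x \<in> simplices (fst A) n\<rbrakk> \<Longrightarrow> amap (gray_runit e p A) n (e (x, p)) = x"
  by (simp add: gray_runit_def simplices_gray_obj simplices_gray_unit)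

lemma scaled_id_arr: "is_scaled A \<Longrightarrow> scaled_id A \<in> scaled_arr"
  using map_id_hom[OF is_scaled_sset[of A]]
  by (auto simp: scaled_arr_def scaled_hom_def scaled_id_def map_id_def thin_simplex)

lemma scaled_comp_arr:
  assumes f: "f \<in> scaled_arr" and g: "g \<in> scaled_arr" and fg: "acod f = adom g"
  shows "scaled_comp g f \<in> scaled_arr"
proof -
  note f' = scaled_arrD[OF f] and g' = scaled_arrD[OF g]
  have "map_comp (fst (adom f)) (amap g) (amap f) \<in> sset_hom (fst (adom f)) (fst (acod g))"
    using map_comp_hom[OF is_scaled_sset[OF f'(1)] f'(3)] g'(3) fg by metis
  then show ?thesis
    using f'(1,2,4) g'(2,4) fg
    by (auto simp: scaled_arr_def scaled_hom_def scaled_comp_def map_comp_apply thin_simplex)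
qed

lemma gray_arr_arr:
  assumes e: "inj e" and f: "f \<in> scaled_arr" and g: "g \<in> scaled_arr"
  shows "gray_arr e f g \<in> scaled_arr"
proof -
  note f' = scaled_arrD[OF f] and g' = scaled_arrD[OF g]
  let ?D = "gray_obj e (adom f) (adom g)" and ?C = "gray_obj e (acod f) (acod g)"
  have scaled: "is_scaled ?D" "is_scaled ?C"
    using e f' g' by (simp_all add: is_scaled_gray_obj)
  have "amap (gray_arr e f g) \<in> sset_hom (fst ?D) (fst ?C)"
    unfolding sset_hom_def
  proof (intro CollectI conjI allI ballI)
    fix n
    show "amap (gray_arr e f g) n \<in> simplices (fst ?D) n \<rightarrow>\<^sub>E simplices (fst ?C) n"
    proof (rule PiE_I)
      fix u assume "u \<in> simplices (fst ?D) n"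
      then show "amap (gray_arr e f g) n u \<in> simplices (fst ?C) n"
        using e f g by (auto simp: simplices_gray_obj amap_gray_arr amap_in)
    qed (simp add: gray_arr_def)
  next
    fix m n \<alpha> u assume \<alpha>: "\<alpha> \<in> Delta m n" and "u \<in> simplices (fst ?D) n"
    then show "amap (gray_arr e f g) m (action (fst ?D) m n \<alpha> u)
        = action (fst ?C) m n \<alpha> (amap (gray_arr e f g) n u)"
      using e f g f'(1) g'(1)
      by (auto simp: simplices_gray_obj amap_gray_arr action_gray_obj action_in is_scaled_sset
          amap_in amap_action)
  qed
  \<comment> \<open>Each factor preserves thinness and degeneracy along its edge, so whichever
    disjunct of the Gray condition holds for \<open>u\<close> survives.\<close>
  moreover have "amap (gray_arr e f g) 2 u \<in> snd ?C" if u: "u \<in> snd ?D" for u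
  proof -
    obtain x y where u_eq: "u = e (x, y)"
      using u by (auto simp: gray_obj_def rename_scaled_def)
    have thin: "x \<in> snd (adom f)" "y \<in> snd (adom g)"
      and along: "degenerates_along (fst (adom f)) 1 x \<or> degenerates_along (fst (adom g)) 0 y"
      using u e by (simp_all add: u_eq thin_gray_obj)
    have xy: "x \<in> simplices (fst (adom f)) 2" "y \<in> simplices (fst (adom g)) 2"
      using thin f'(1) g'(1) by (simp_all add: thin_simplex)
    show ?thesis
      using along e thin xy f'(4) g'(4) degenerates_along_hom[OF f'(3) xy(1), of 1]
        degenerates_along_hom[OF g'(3) xy(2), of 0]
      by (auto simp: u_eq amap_gray_arr thin_gray_obj)
  qed
  ultimately show ?thesis
    using scaled by (simp add: scaled_arr_def scaled_hom_def)
qed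

section \<open>The category of scaled simplicial sets\<close>

interpretation scaled: category scaled_obj scaled_arr adom acod scaled_id scaled_comp
proof
  fix f :: "'u arrow" assume f: "f \<in> scaled_arr"
  show "adom f \<in> scaled_obj" "acod f \<in> scaled_obj"
    using scaled_arrD[OF f] by (simp_all add: scaled_obj_def)
  show "scaled_comp f (scaled_id (adom f)) = f"
    by (rule scaled_arr_eqI)
      (use f scaled_arrD[OF f] in
        \<open>simp_all add: scaled_comp_arr scaled_id_arr amap_scaled_comp amap_scaled_id\<close>)
  show "scaled_comp (scaled_id (acod f)) f = f"
    by (rule scaled_arr_eqI)
      (use f scaled_arrD[OF f] in
        \<open>simp_all add: scaled_comp_arr scaled_id_arr amap_scaled_comp amap_scaled_id amap_in\<close>)
next
  fix X :: "'u scaled" assume "X \<in> scaled_obj"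
  then show "scaled_id X \<in> scaled_arr \<and> adom (scaled_id X) = X \<and> acod (scaled_id X) = X"
    by (simp add: scaled_obj_def scaled_id_arr)
next
  fix f g :: "'u arrow" assume "f \<in> scaled_arr" "g \<in> scaled_arr" "acod f = adom g"
  then show "scaled_comp g f \<in> scaled_arr \<and> adom (scaled_comp g f) = adom f
      \<and> acod (scaled_comp g f) = acod g"
    by (simp add: scaled_comp_arr)
next
  fix f g h :: "'u arrow"
  assume fgh: "f \<in> scaled_arr" "g \<in> scaled_arr" "h \<in> scaled_arr"
    "acod f = adom g" "acod g = adom h"
  show "scaled_comp (scaled_comp h g) f = scaled_comp h (scaled_comp g f)"
  proof (rule scaled_arr_eqI)
    fix n x assume "x \<in> simplices (fst (adom (scaled_comp (scaled_comp h g) f))) n"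
    then show "amap (scaled_comp (scaled_comp h g) f) n x
        = amap (scaled_comp h (scaled_comp g f)) n x"
      using fgh amap_in[of f x n] by (simp add: amap_scaled_comp)
  qed (use fgh in \<open>simp_all add: scaled_comp_arr\<close>)
qed

section \<open>Isomorphisms in the category: associator and unitors\<close>

lemma scaled_iso_arr:
  assumes "is_scaled (adom f)" "is_scaled (acod f)" "scaled_iso (adom f) (acod f) (amap f)"
  shows "f \<in> scaled.iso (adom f) (acod f)"
proof -
  obtain g where g: "g \<in> scaled_hom (acod f) (adom f)"
    "map_comp (fst (adom f)) g (amap f) = map_id (fst (adom f))"
    "map_comp (fst (acod f)) (amap f) g = map_id (fst (acod f))"
    and f: "amap f \<in> scaled_hom (adom f) (acod f)"
    using assms(3) unfolding scaled_iso_def by blast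
  let ?g = "\<lparr>adom = acod f, amap = g, acod = adom f\<rparr>"
  have "?g \<in> scaled.hom (acod f) (adom f)" "f \<in> scaled.hom (adom f) (acod f)"
    unfolding scaled.hom_def using g(1) f assms by (simp_all add: scaled_arr_def)
  moreover have "scaled_comp ?g f = scaled_id (adom f)" "scaled_comp f ?g = scaled_id (acod f)"
    using g by (simp_all add: scaled_comp_def scaled_id_def)
  ultimately show ?thesis
    unfolding scaled.iso_def by blast
qed

text \<open>A common criterion for associator and unitors. Bijectivity is asked elementwise because
  the simplices are values of \<open>e\<close>, where injectivity and surjectivity are read off from
  tuples.\<close>

lemma scaled_iso_arrI:
  assumes "is_scaled (adom f)" "is_scaled (acod f)"
    and in_cod: "\<And>n x. x \<in> simplices (fst (adom f)) n \<Longrightarrow> amap f n x \<in> simplices (fst (acod f)) n"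
    and ext: "\<And>n. amap f n \<in> extensional (simplices (fst (adom f)) n)"
    and nat: "\<And>m n \<alpha> x. \<lbrakk>\<alpha> \<in> Delta m n; x \<in> simplices (fst (adom f)) n\<rbrakk>
      \<Longrightarrow> amap f m (action (fst (adom f)) m n \<alpha> x) = action (fst (acod f)) m n \<alpha> (amap f n x)"
    and inj: "\<And>n x y. \<lbrakk>x \<in> simplices (fst (adom f)) n; y \<in> simplices (fst (adom f)) n;
      amap f n x = amap f n y\<rbrakk> \<Longrightarrow> x = y"
    and surj: "\<And>n y. y \<in> simplices (fst (acod f)) n
      \<Longrightarrow> \<exists>x\<in>simplices (fst (adom f)) n. y = amap f n x"
    and thin: "\<And>\<sigma>. \<sigma> \<in> simplices (fst (adom f)) 2 \<Longrightarrow> amap f 2 \<sigma> \<in> snd (acod f) \<longleftrightarrow> \<sigma> \<in> snd (adom f)"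
  shows "f \<in> scaled.iso (adom f) (acod f)"
proof (intro scaled_iso_arr scaled_isoI)
  show "amap f \<in> sset_hom (fst (adom f)) (fst (acod f))"
    unfolding sset_hom_def using in_cod ext nat by (auto simp: PiE_iff)
  show "bij_betw (amap f n) (simplices (fst (adom f)) n) (simplices (fst (acod f)) n)" for n
    using in_cod inj surj by (intro bij_betwI') blast+
qed (use assms in auto)

lemma gray_assoc_iso:
  assumes e: "inj e" and A: "is_scaled A" and B: "is_scaled B" and C: "is_scaled C"
  shows "gray_assoc e A B C
    \<in> scaled.iso (gray_obj e (gray_obj e A B) C) (gray_obj e A (gray_obj e B C))"
proof -
  have "gray_assoc e A B C \<in> scaled.iso (adom (gray_assoc e A B C)) (acod (gray_assoc e A B C))"
  proof (rule scaled_iso_arrI)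
    fix n x y
    assume "x \<in> simplices (fst (adom (gray_assoc e A B C))) n"
      "y \<in> simplices (fst (adom (gray_assoc e A B C))) n"
      "amap (gray_assoc e A B C) n x = amap (gray_assoc e A B C) n y"
    then show "x = y"
      using e by (auto simp: simplices_gray_obj amap_gray_assoc inj_eq)
  next
    fix n y assume "y \<in> simplices (fst (acod (gray_assoc e A B C))) n"
    then show "\<exists>x\<in>simplices (fst (adom (gray_assoc e A B C))) n. y = amap (gray_assoc e A B C) n x"
      using e by (force simp: simplices_gray_obj amap_gray_assoc)
  next
    \<comment> \<open>On \<sigma> of the form \<open>e (e (x, y), z)\<close> both conditions unfold
      to the propositional equivalence that underlies \<open>thin_gray_gray\<close>.\<close>
    fix \<sigma> assume "\<sigma> \<in> simplices (fst (adom (gray_assoc e A B C))) 2"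
    then show "amap (gray_assoc e A B C) 2 \<sigma> \<in> snd (acod (gray_assoc e A B C))
        \<longleftrightarrow> \<sigma> \<in> snd (adom (gray_assoc e A B C))"
      using assms
      by (auto simp: simplices_gray_obj amap_gray_assoc thin_gray_obj degenerates_along_gray_obj)
  next
    fix n
    show "amap (gray_assoc e A B C) n \<in> extensional (simplices (fst (adom (gray_assoc e A B C))) n)"
      by (simp add: gray_assoc_def)
  qed (use assms in \<open>auto simp: is_scaled_gray_obj simplices_gray_obj amap_gray_assoc
        action_gray_obj action_in is_scaled_sset\<close>)
  then show ?thesis by simp
qed

lemma gray_lunit_iso:
  assumes e: "inj e" and A: "is_scaled A"
  shows "gray_lunit e p A \<in> scaled.iso (gray_obj e (gray_unit p) A) A"
proof -
  have "gray_lunit e p A \<in> scaled.iso (adom (gray_lunit e p A)) (acod (gray_lunit e p A))"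
  proof (rule scaled_iso_arrI)
    fix \<sigma> assume "\<sigma> \<in> simplices (fst (adom (gray_lunit e p A))) 2"
    then show "amap (gray_lunit e p A) 2 \<sigma> \<in> snd (acod (gray_lunit e p A))
        \<longleftrightarrow> \<sigma> \<in> snd (adom (gray_lunit e p A))"
      \<comment> \<open>The unit is the first factor here, so its degeneracy along the edge {1,2}
        fulfils the Gray condition.\<close>
      using assms degenerates_along_gray_unit[of 1 p]
      by (auto simp: simplices_gray_obj simplices_gray_unit amap_gray_lunit thin_gray_obj
          thin_gray_unit)
  next
    fix n
    show "amap (gray_lunit e p A) n \<in> extensional (simplices (fst (adom (gray_lunit e p A))) n)"
      by (simp add: gray_lunit_def)
  qed (use assms in \<open>auto simp: is_scaled_gray_obj is_scaled_gray_unit simplices_gray_obj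
        simplices_gray_unit amap_gray_lunit action_gray_obj action_gray_unit action_in
        is_scaled_sset\<close>)
  then show ?thesis by simp
qed

lemma gray_runit_iso:
  assumes e: "inj e" and A: "is_scaled A"
  shows "gray_runit e p A \<in> scaled.iso (gray_obj e A (gray_unit p)) A"
proof -
  have "gray_runit e p A \<in> scaled.iso (adom (gray_runit e p A)) (acod (gray_runit e p A))"
  proof (rule scaled_iso_arrI)
    fix \<sigma> assume "\<sigma> \<in> simplices (fst (adom (gray_runit e p A))) 2"
    then show "amap (gray_runit e p A) 2 \<sigma> \<in> snd (acod (gray_runit e p A))
        \<longleftrightarrow> \<sigma> \<in> snd (adom (gray_runit e p A))"
      \<comment> \<open>As second factor the unit contributes degeneracy along the edge {0,1}
        instead.\<close>
      using assms degenerates_along_gray_unit[of 0 p]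
      by (auto simp: simplices_gray_obj simplices_gray_unit amap_gray_runit thin_gray_obj
          thin_gray_unit)
  next
    fix n
    show "amap (gray_runit e p A) n \<in> extensional (simplices (fst (adom (gray_runit e p A))) n)"
      by (simp add: gray_runit_def)
  qed (use assms in \<open>auto simp: is_scaled_gray_obj is_scaled_gray_unit simplices_gray_obj
        simplices_gray_unit amap_gray_runit action_gray_obj action_gray_unit action_in
        is_scaled_sset\<close>)
  then show ?thesis by simp
qed

lemma scaled_iso_in_arr: "f \<in> scaled.iso A B \<Longrightarrow> f \<in> scaled_arr"
  by (simp add: scaled.iso_def scaled.hom_def)

text \<open>All equational axioms follow one scheme: \<open>arrs\<close> shows that both sides are
  arrows, and \<open>amaps\<close> evaluates them on simplices written as nested pairs, where they
  become the same rearrangement of components.\<close>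

lemma gray_monoidal:
  fixes e :: "'u \<times> 'u \<Rightarrow> 'u"
  assumes e: "inj e"
  shows "monoidal_category scaled_obj scaled_arr adom acod scaled_id scaled_comp
    (gray_obj e) (gray_arr e) (gray_unit p) (gray_assoc e) (gray_lunit e p) (gray_runit e p)"
proof -
  note arrs = scaled_comp_arr scaled_id_arr gray_arr_arr[OF e] is_scaled_gray_obj[OF e]
    is_scaled_gray_unit gray_assoc_iso[OF e, THEN scaled_iso_in_arr]
    gray_lunit_iso[OF e, THEN scaled_iso_in_arr] gray_runit_iso[OF e, THEN scaled_iso_in_arr]
  note amaps = simplices_gray_obj simplices_gray_unit amap_scaled_comp amap_scaled_id
    amap_gray_arr[OF e] amap_gray_assoc[OF e] amap_gray_lunit[OF e] amap_gray_runit[OF e] amap_in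
  show ?thesis
  proof
    fix X Y :: "'u scaled" assume "X \<in> scaled_obj" "Y \<in> scaled_obj"
    then have XY: "is_scaled X" "is_scaled Y" by (simp_all add: scaled_obj_def)
    then show "gray_obj e X Y \<in> scaled_obj" by (simp add: scaled_obj_def arrs)
    show "gray_arr e (scaled_id X) (scaled_id Y) = scaled_id (gray_obj e X Y)"
      by (rule scaled_arr_eqI) (use XY in \<open>auto simp: arrs amaps\<close>)
    show "scaled_comp (gray_arr e (scaled_id X) (gray_lunit e p Y)) (gray_assoc e X (gray_unit p) Y)
        = gray_arr e (gray_runit e p X) (scaled_id Y)"
      by (rule scaled_arr_eqI) (use XY in \<open>auto simp: arrs amaps\<close>)
  next
    fix f g :: "'u arrow" assume fg: "f \<in> scaled_arr" "g \<in> scaled_arr"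
    then show "gray_arr e f g
        \<in> scaled.hom (gray_obj e (adom f) (adom g)) (gray_obj e (acod f) (acod g))"
      by (simp add: scaled.hom_def arrs)
    fix f' g' :: "'u arrow"
    assume "f' \<in> scaled_arr" "g' \<in> scaled_arr" "acod f = adom f'" "acod g = adom g'"
    note fg' = this
    \<comment> \<open>Evaluating \<open>gray_arr e f' g'\<close> after \<open>gray_arr e f g\<close>
      needs the intermediate values in the domains of \<open>f'\<close> and \<open>g'\<close>,
      whereas \<open>amap_in\<close> places them in the codomains of \<open>f\<close> and
      \<open>g\<close>.\<close>
    have "amap f n x \<in> simplices (fst (adom f')) n" if "x \<in> simplices (fst (adom f)) n" for n x
      using amap_in[OF fg(1) that] fg' by simp
    moreover have "amap g n x \<in> simplices (fst (adom g')) n"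
      if "x \<in> simplices (fst (adom g)) n" for n x
      using amap_in[OF fg(2) that] fg' by simp
    ultimately show "gray_arr e (scaled_comp f' f) (scaled_comp g' g)
        = scaled_comp (gray_arr e f' g') (gray_arr e f g)"
      by (intro scaled_arr_eqI) (use fg fg' in \<open>auto simp: arrs amaps\<close>)
  next
    show "gray_unit p \<in> scaled_obj" by (simp add: scaled_obj_def arrs)
  next
    fix X Y Z :: "'u scaled" assume "X \<in> scaled_obj" "Y \<in> scaled_obj" "Z \<in> scaled_obj"
    then show "gray_assoc e X Y Z
        \<in> scaled.iso (gray_obj e (gray_obj e X Y) Z) (gray_obj e X (gray_obj e Y Z))"
      by (simp add: scaled_obj_def gray_assoc_iso[OF e])
  next
    fix f g h :: "'u arrow" assume "f \<in> scaled_arr" "g \<in> scaled_arr" "h \<in> scaled_arr"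
    then show "scaled_comp (gray_assoc e (acod f) (acod g) (acod h)) (gray_arr e (gray_arr e f g) h)
        = scaled_comp (gray_arr e f (gray_arr e g h)) (gray_assoc e (adom f) (adom g) (adom h))"
      by (intro scaled_arr_eqI) (auto simp: arrs amaps scaled_arrD(1,2))
  next
    fix X :: "'u scaled" assume "X \<in> scaled_obj"
    then show "gray_lunit e p X \<in> scaled.iso (gray_obj e (gray_unit p) X) X"
      "gray_runit e p X \<in> scaled.iso (gray_obj e X (gray_unit p)) X"
      by (simp_all add: scaled_obj_def gray_lunit_iso[OF e] gray_runit_iso[OF e])
  next
    fix f :: "'u arrow" assume f: "f \<in> scaled_arr"
    show "scaled_comp (gray_lunit e p (acod f)) (gray_arr e (scaled_id (gray_unit p)) f)
        = scaled_comp f (gray_lunit e p (adom f))"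
      by (rule scaled_arr_eqI) (use f in \<open>auto simp: arrs amaps scaled_arrD(1,2)\<close>)
    show "scaled_comp (gray_runit e p (acod f)) (gray_arr e f (scaled_id (gray_unit p)))
        = scaled_comp f (gray_runit e p (adom f))"
      by (rule scaled_arr_eqI) (use f in \<open>auto simp: arrs amaps scaled_arrD(1,2)\<close>)
  next
    fix W X Y Z :: "'u scaled"
    assume "W \<in> scaled_obj" "X \<in> scaled_obj" "Y \<in> scaled_obj" "Z \<in> scaled_obj"
    then show "scaled_comp (gray_assoc e W X (gray_obj e Y Z)) (gray_assoc e (gray_obj e W X) Y Z)
        = scaled_comp (gray_arr e (scaled_id W) (gray_assoc e X Y Z))
            (scaled_comp (gray_assoc e W (gray_obj e X Y) Z)
              (gray_arr e (gray_assoc e W X Y) (scaled_id Z)))"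
      by (intro scaled_arr_eqI) (auto simp: arrs amaps scaled_obj_def)
  qed
qed

theorem proposition2p2:
  shows "(\<forall>(X :: 'a sset) TX (Y :: 'b sset) TY (Z :: 'c sset) TZ.
            is_scaled (X, TX) \<and> is_scaled (Y, TY) \<and> is_scaled (Z, TZ) \<longrightarrow>
            sset_iso (sset_prod (sset_prod X Y) Z) (sset_prod X (sset_prod Y Z)) (assoc_map X Y Z) \<and>
            is_scaled (gray (gray (X, TX) (Y, TY)) (Z, TZ)) \<and>
            is_scaled (gray (X, TX) (gray (Y, TY) (Z, TZ))) \<and>
            scaled_iso (gray (gray (X, TX) (Y, TY)) (Z, TZ)) (gray (X, TX) (gray (Y, TY) (Z, TZ)))
              (assoc_map X Y Z)) \<and>
         (\<forall>(e :: 'u \<times> 'u \<Rightarrow> 'u) (p :: 'u). inj e \<longrightarrow>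
            monoidal_category scaled_obj scaled_arr adom acod scaled_id scaled_comp
              (gray_obj e) (gray_arr e) (gray_unit p)
              (gray_assoc e) (gray_lunit e p) (gray_runit e p))"
proof (intro conjI allI impI)
  fix X :: "'a sset" and TX and Y :: "'b sset" and TY and Z :: "'c sset" and TZ
  assume scaled: "is_scaled (X, TX) \<and> is_scaled (Y, TY) \<and> is_scaled (Z, TZ)"
  then show "sset_iso (sset_prod (sset_prod X Y) Z) (sset_prod X (sset_prod Y Z)) (assoc_map X Y Z)"
    by (intro assoc_map_sset_iso) (auto dest: is_scaled_sset)
  show "is_scaled (gray (gray (X, TX) (Y, TY)) (Z, TZ))"
    "is_scaled (gray (X, TX) (gray (Y, TY) (Z, TZ)))"
    using scaled by (simp_all add: is_scaled_gray)
  show "scaled_iso (gray (gray (X, TX) (Y, TY)) (Z, TZ)) (gray (X, TX) (gray (Y, TY) (Z, TZ)))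
      (assoc_map X Y Z)"
    using scaled assoc_map_scaled_iso[of "(X, TX)" "(Y, TY)" "(Z, TZ)"] by simp
qed (rule gray_monoidal)

end
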